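(* Let $t_{\mathrm{mix}}=t_{\mathrm{mix}}(n,\beta)$ be the mixing time of the logit dynamics with inverse noise $\beta\ge 0$ for the $n$-player OR game. Then $t_{\mathrm{mix}}=\mathcal{O}(n^{5/2}2^n)$ for every $\beta$; that is, there is a constant $K>0$ such that $t_{\mathrm{mix}}\le K n^{5/2}2^n$ for all $n\ge 2$ and all $\beta\ge 0$. Moreover: 1. for every constant $\varepsilon>0$ (arbitrarily small) there is a constant $K_\varepsilon>0$ such that $t_{\mathrm{mix}}\le K_\varepsilon\, n\log n$ for all $n\ge 2$ and all $\beta\ge 0$ with $\beta<(1-\varepsilon)\log n$; 2. for every constant $c\ge 1$ there is a constant $K'_c>0$ such that $t_{\mathrm{mix}}\le K'_c\, n^{c+3}\log n$ for all $n\ge 2$ and all $\beta\ge 0$ with $\beta\le c\log n$. Here $\log$ is the natural logarithm.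
   Context: OR game: $n$ players, each with strategy set $\{0,1\}$; for every player $i$, $u_i(\mathbf{x})=0$ if $\mathbf{x}=(0,\dots,0)$ and $u_i(\mathbf{x})=-1$ otherwise. Logit dynamics: for a strategic game with $n$ players, finite strategy sets $S_i$ and utilities $u_i:\prod_j S_j\to\mathbb{R}$, and for $\beta\ge 0$, let $\sigma_i(y\mid\mathbf{x})=e^{\beta u_i(\mathbf{x}_{-i},y)}/\sum_{z\in S_i}e^{\beta u_i(\mathbf{x}_{-i},z)}$, where $(\mathbf{x}_{-i},y)$ is $\mathbf{x}$ with its $i$-th entry replaced by $y$. The logit dynamics with inverse noise $\beta$ is the Markov chain on $\Omega=\prod_j S_j$ which, from profile $\mathbf{x}$, selects a player $i$ uniformly at random and replaces $x_i$ by $y\in S_i$ with probability $\sigma_i(y\mid\mathbf{x})$. It is irreducible and aperiodic; let $P$ be its transition matrix and $\pi$ its unique stationary distribution. The mixing time is $t_{\mathrm{mix}}=\min\{t\in\mathbb{N}:\max_{\mathbf{x}\in\Omega}\|P^t(\mathbf{x},\cdot)-\pi\|_{\mathrm{TV}}\le 1/4\}$, where $\|\mu-\nu\|_{\mathrm{TV}}=\max_{A\subseteq\Omega}|\mu(A)-\nu(A)|$. *)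

theory Defs
  imports "HOL-Probability.Probability"
begin

text \<open>
  A strategic game with players \<open>{..<n}\<close> is given by strategy sets \<open>S i\<close> and utilities \<open>u i\<close>
  for \<open>i < n\<close>; profiles are extensional functions, so that \<open>x(i := y)\<close> is the profile
  in which player \<open>i\<close> deviates to \<open>y\<close>.
\<close>

definition profiles :: "nat \<Rightarrow> (nat \<Rightarrow> 's set) \<Rightarrow> (nat \<Rightarrow> 's) set" where
  "profiles n S = (\<Pi>\<^sub>E i\<in>{..<n}. S i)"

definition logit_prob ::
  "(nat \<Rightarrow> 's set) \<Rightarrow> (nat \<Rightarrow> (nat \<Rightarrow> 's) \<Rightarrow> real) \<Rightarrow> real \<Rightarrow> nat \<Rightarrow> (nat \<Rightarrow> 's) \<Rightarrow> 's \<Rightarrow> real" where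
  "logit_prob S u \<beta> i x y =
     exp (\<beta> * u i (x(i := y))) / (\<Sum>z\<in>S i. exp (\<beta> * u i (x(i := z))))"

definition logit_choice ::
  "(nat \<Rightarrow> 's set) \<Rightarrow> (nat \<Rightarrow> (nat \<Rightarrow> 's) \<Rightarrow> real) \<Rightarrow> real \<Rightarrow> nat \<Rightarrow> (nat \<Rightarrow> 's) \<Rightarrow> 's pmf" where
  "logit_choice S u \<beta> i x = embed_pmf (\<lambda>y. if y \<in> S i then logit_prob S u \<beta> i x y else 0)"

text \<open>The side condition of \<^const>\<open>embed_pmf\<close> holds for finite nonempty strategy sets.\<close>

lemma pmf_logit_choice:
  assumes fin: "finite (S i)" and ne: "S i \<noteq> {}"
  shows "pmf (logit_choice S u \<beta> i x) y = (if y \<in> S i then logit_prob S u \<beta> i x y else 0)"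
proof -
  let ?f = "\<lambda>y. if y \<in> S i then logit_prob S u \<beta> i x y else 0"
  have pos: "(\<Sum>z\<in>S i. exp (\<beta> * u i (x(i := z)))) > 0"
    using assms by (intro sum_pos) auto
  have nonneg: "0 \<le> ?f y" for y
    using pos by (auto simp: logit_prob_def)
  have "(\<integral>\<^sup>+ y. ennreal (?f y) \<partial>count_space UNIV) = (\<Sum>y\<in>S i. ennreal (?f y))"
    using fin by (intro nn_integral_count_space') auto
  also have "\<dots> = ennreal (\<Sum>y\<in>S i. ?f y)"
    by (rule sum_ennreal) (rule nonneg)
  also have "(\<Sum>y\<in>S i. ?f y) = 1"
    using pos by (simp add: logit_prob_def flip: sum_divide_distrib)
  finally have "(\<integral>\<^sup>+ y. ennreal (?f y) \<partial>count_space UNIV) = 1" by simp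
  then show ?thesis
    unfolding logit_choice_def using nonneg by (subst pmf_embed_pmf) auto
qed

definition logit_step ::
  "nat \<Rightarrow> (nat \<Rightarrow> 's set) \<Rightarrow> (nat \<Rightarrow> (nat \<Rightarrow> 's) \<Rightarrow> real) \<Rightarrow> real \<Rightarrow> (nat \<Rightarrow> 's) \<Rightarrow> (nat \<Rightarrow> 's) pmf" where
  "logit_step n S u \<beta> x =
     bind_pmf (pmf_of_set {..<n}) (\<lambda>i. map_pmf (\<lambda>y. x(i := y)) (logit_choice S u \<beta> i x))"

text \<open>
  For a Markov chain with transition kernel \<open>K\<close>, the distribution \<open>iter_kernel K t x\<close> is the row
  of the \<open>t\<close>-th power of the transition matrix at \<open>x\<close>.
\<close>

definition iter_kernel :: "('a \<Rightarrow> 'a pmf) \<Rightarrow> nat \<Rightarrow> 'a \<Rightarrow> 'a pmf" where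
  "iter_kernel K t x = ((\<lambda>\<mu>. bind_pmf \<mu> K) ^^ t) (return_pmf x)"

definition is_stationary :: "'a set \<Rightarrow> ('a \<Rightarrow> 'a pmf) \<Rightarrow> 'a pmf \<Rightarrow> bool" where
  "is_stationary \<Omega> K \<pi> \<longleftrightarrow> set_pmf \<pi> \<subseteq> \<Omega> \<and> bind_pmf \<pi> K = \<pi>"

definition stationary_dist :: "'a set \<Rightarrow> ('a \<Rightarrow> 'a pmf) \<Rightarrow> 'a pmf" where
  "stationary_dist \<Omega> K = (THE \<pi>. is_stationary \<Omega> K \<pi>)"

definition tv_dist :: "'a set \<Rightarrow> 'a pmf \<Rightarrow> 'a pmf \<Rightarrow> real" where
  "tv_dist \<Omega> \<mu> \<nu> =
     Max ((\<lambda>A. \<bar>measure_pmf.prob \<mu> A - measure_pmf.prob \<nu> A\<bar>) ` Pow \<Omega>)"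

text \<open>
  The definition is meaningful for finite nonempty \<open>\<Omega>\<close> and \<open>K\<close> irreducible and
  aperiodic on \<open>\<Omega>\<close>: then the stationary distribution is unique and the set of times is nonempty.
\<close>

definition mixing_time :: "'a set \<Rightarrow> ('a \<Rightarrow> 'a pmf) \<Rightarrow> nat" where
  "mixing_time \<Omega> K =
     (LEAST t. Max ((\<lambda>x. tv_dist \<Omega> (iter_kernel K t x) (stationary_dist \<Omega> K)) ` \<Omega>) \<le> 1 / 4)"

definition logit_mixing_time ::
  "nat \<Rightarrow> (nat \<Rightarrow> 's set) \<Rightarrow> (nat \<Rightarrow> (nat \<Rightarrow> 's) \<Rightarrow> real) \<Rightarrow> real \<Rightarrow> nat" where
  "logit_mixing_time n S u \<beta> = mixing_time (profiles n S) (logit_step n S u \<beta>)"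

definition OR_strategies :: "nat \<Rightarrow> nat set" where
  "OR_strategies i = {0, 1}"

definition OR_utility :: "nat \<Rightarrow> nat \<Rightarrow> (nat \<Rightarrow> nat) \<Rightarrow> real" where
  "OR_utility n i x = (if \<forall>j<n. x j = 0 then 0 else - 1)"

definition OR_mixing_time :: "nat \<Rightarrow> real \<Rightarrow> nat" where
  "OR_mixing_time n \<beta> = logit_mixing_time n OR_strategies (OR_utility n) \<beta>"

end

theory Submission
  imports Defs
begin

text \<open>
  The proof is the dual form of path coupling. Let \<open>q = 1 / (1 + exp \<beta>)\<close> be the probability of
  playing \<open>1\<close> against all zeros. If the increment of \<open>f\<close> along each edge of the hypercube from a
  profile with \<open>k\<close> ones to one with \<open>k + 1\<close> ones is at most \<open>w k\<close>, then the increments of its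
  one-step average are bounded by an explicit tridiagonal operator applied to \<open>w\<close>. A weight \<open>w\<close>
  that this operator contracts by \<open>1 - \<alpha>\<close> makes the laws from any two starting profiles merge at
  rate \<open>1 - \<alpha>\<close>, up to the ratio of \<open>\<Sum>k<n. w k\<close> to the smallest \<open>w k\<close>. One family of weights, built
  from binomial tails, gives a gap of order \<open>(q + 2 ^ (- n)) / n\<close> and hence the exponential and the
  polynomial bound; when \<open>q\<close> is at least of order \<open>1 / n\<close>, weights that are constant from level 2 on
  give a gap of order \<open>1 / n\<close>. The finitely many small \<open>n\<close> of the \<open>n log n\<close> regime are covered by the
  exponential bound.
\<close>

section \<open>Logit dynamics of finite games\<close>

lemma logit_choice_set: 
  assumes "finite (S i)" "S i \<noteq> {}"
  shows "set_pmf (logit_choice S u \<beta> i x) \<subseteq> S i"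
proof
  fix y assume "y \<in> set_pmf (logit_choice S u \<beta> i x)"
  then show "y \<in> S i" using pmf_logit_choice[where S = S and i = i and u = u and \<beta> = \<beta> and x = x and y = y] assms
    by (auto simp: set_pmf_iff split: if_splits)
qed

lemma profiles_upd: "x \<in> profiles n S \<Longrightarrow> i < n \<Longrightarrow> y \<in> S i \<Longrightarrow> x(i := y) \<in> profiles n S"
  by (auto simp: profiles_def PiE_iff extensional_def)

lemma finite_profiles: "(\<And>i. i < n \<Longrightarrow> finite (S i)) \<Longrightarrow> finite (profiles n S)"
  unfolding profiles_def by (intro finite_PiE) auto

lemma expectation_logit_step:
  fixes f :: "(nat \<Rightarrow> 's) \<Rightarrow> real"
  assumes n: "0 < n" and S: "\<And>i. i < n \<Longrightarrow> finite (S i) \<and> S i \<noteq> {}"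
  shows "measure_pmf.expectation (logit_step n S u \<beta> x) f =
    (\<Sum>i<n. \<Sum>y\<in>S i. logit_prob S u \<beta> i x y * f (x(i := y))) / real n"
proof -
  have ne: "{..<n} \<noteq> {}" using n by auto
  have choice: "measure_pmf.expectation (map_pmf (\<lambda>y. x(i := y)) (logit_choice S u \<beta> i x)) f =
      (\<Sum>y\<in>S i. logit_prob S u \<beta> i x y * f (x(i := y)))" if "i < n" for i
  proof -
    have "measure_pmf.expectation (map_pmf (\<lambda>y. x(i := y)) (logit_choice S u \<beta> i x)) f =
      (\<Sum>y\<in>S i. pmf (logit_choice S u \<beta> i x) y *\<^sub>R f (x(i := y)))"
      unfolding integral_map_pmf using S[OF that] logit_choice_set[of S i u \<beta> x]
      by (intro integral_measure_pmf) auto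
    then show ?thesis using S[OF that] by (simp add: pmf_logit_choice)
  qed
  have "measure_pmf.expectation (logit_step n S u \<beta> x) f =
    (\<Sum>i<n. pmf (pmf_of_set {..<n}) i *\<^sub>R
       measure_pmf.expectation (map_pmf (\<lambda>y. x(i := y)) (logit_choice S u \<beta> i x)) f)"
    unfolding logit_step_def
  proof (rule pmf_expectation_bind)
    fix i assume "i \<in> {..<n}"
    then show "finite (set_pmf (map_pmf (\<lambda>y. x(i := y)) (logit_choice S u \<beta> i x)))"
      using S[of i] logit_choice_set[of S i u \<beta> x] finite_subset by fastforce
  qed (use ne in auto)
  also have "\<dots> = (\<Sum>i<n. (\<Sum>y\<in>S i. logit_prob S u \<beta> i x y * f (x(i := y))) / real n)"
    using ne by (intro sum.cong) (auto simp: choice simp del: integral_map_pmf)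
  finally show ?thesis by (simp add: sum_divide_distrib)
qed

lemma set_logit_step:
  assumes n: "0 < n" and S: "\<And>i. i < n \<Longrightarrow> finite (S i) \<and> S i \<noteq> {}" and x: "x \<in> profiles n S"
  shows "set_pmf (logit_step n S u \<beta> x) \<subseteq> profiles n S"
proof -
  have ne: "{..<n} \<noteq> {}" using n by auto
  show ?thesis
    unfolding logit_step_def set_bind_pmf set_map_pmf set_pmf_of_set[OF ne finite_lessThan]
    using logit_choice_set S profiles_upd[OF x] by (fastforce simp: subset_iff)
qed

text \<open>With a common utility \<Phi> the game is a potential game, and detailed balance makes
  the Gibbs measure, proportional to \<open>exp (\<beta> * \<Phi> x)\<close>, stationary. Existence
  matters because \<open>stationary_dist\<close> is a definite description.\<close>

lemma logit_stationary_exists: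
  assumes n: "0 < n" and S: "\<And>i. i < n \<Longrightarrow> finite (S i) \<and> S i \<noteq> {}"
    and u: "\<And>i. i < n \<Longrightarrow> u i = \<Phi>"
  shows "\<exists>\<pi>. is_stationary (profiles n S) (logit_step n S u \<beta>) \<pi>"
proof -
  let ?\<Omega> = "profiles n S"
  define m where "m x = exp (\<beta> * \<Phi> x)" for x
  define Z where "Z = (\<Sum>x\<in>?\<Omega>. m x)"
  have fin: "finite ?\<Omega>" using S finite_profiles by blast
  have ne: "?\<Omega> \<noteq> {}" using S by (auto simp: profiles_def PiE_eq_empty_iff)
  have Z: "Z > 0" unfolding Z_def m_def using fin ne by (intro sum_pos) auto
  let ?g = "\<lambda>x. if x \<in> ?\<Omega> then m x / Z else 0"
  define \<pi> where "\<pi> = embed_pmf ?g"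
  have nonneg: "0 \<le> ?g x" for x using Z by (simp add: m_def)
  have "(\<integral>\<^sup>+ x. ennreal (?g x) \<partial>count_space UNIV) = (\<Sum>x\<in>?\<Omega>. ennreal (?g x))"
    using fin by (intro nn_integral_count_space') auto
  also have "\<dots> = ennreal (\<Sum>x\<in>?\<Omega>. ?g x)"
    by (rule sum_ennreal) (rule nonneg)
  also have "(\<Sum>x\<in>?\<Omega>. ?g x) = 1"
    using Z by (simp add: Z_def flip: sum_divide_distrib)
  finally have pmf: "pmf \<pi> x = ?g x" for x
    unfolding \<pi>_def using nonneg by (subst pmf_embed_pmf) auto
  have set: "set_pmf \<pi> \<subseteq> ?\<Omega>" by (auto simp: set_pmf_iff pmf split: if_splits)
  have "measure_pmf.expectation (bind_pmf \<pi> (logit_step n S u \<beta>)) f = measure_pmf.expectation \<pi> f"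
    for f :: "_ \<Rightarrow> real"
  proof -
    have site: "(\<Sum>x\<in>?\<Omega>. m x * (\<Sum>y\<in>S i. logit_prob S u \<beta> i x y * f (x(i := y)))) =
        (\<Sum>x\<in>?\<Omega>. m x * f x)" if i: "i < n" for i
    proof -
      define z where "z x = (\<Sum>y\<in>S i. m (x(i := y)))" for x
      have z: "z x > 0" for x unfolding z_def m_def using S[OF i] by (intro sum_pos) auto
      have z_upd: "z (x(i := y)) = z x" for x y by (simp add: z_def)
      have "(\<Sum>x\<in>?\<Omega>. m x * (\<Sum>y\<in>S i. logit_prob S u \<beta> i x y * f (x(i := y)))) =
        (\<Sum>(x, y)\<in>?\<Omega> \<times> S i. m x * m (x(i := y)) / z x * f (x(i := y)))"
        by (simp add: sum.cartesian_product[symmetric] sum_distrib_left logit_prob_def m_def z_def u[OF i] mult.assoc)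
      \<comment> \<open>The involution exchanging the old and the new entry of player
        \<open>i\<close> preserves the coefficient, since \<open>z\<close> does not depend on entry
        \<open>i\<close>.\<close>
      also have "\<dots> = (\<Sum>(x, y)\<in>?\<Omega> \<times> S i. m x * m (x(i := y)) / z x * f x)"
        by (rule sum.reindex_bij_witness[where i = "\<lambda>(x, y). (x(i := y), x i)"
              and j = "\<lambda>(x, y). (x(i := y), x i)"])
          (use i in \<open>auto simp: z_upd mult.commute intro: profiles_upd, (auto simp: profiles_def)\<close>)
      also have "\<dots> = (\<Sum>x\<in>?\<Omega>. m x * f x * ((\<Sum>y\<in>S i. m (x(i := y))) / z x))"
        by (simp add: sum.cartesian_product[symmetric] sum_distrib_left sum_divide_distrib algebra_simps)
      also have "\<dots> = (\<Sum>x\<in>?\<Omega>. m x * f x)"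
        using z unfolding z_def[symmetric] by (simp add: less_imp_neq[THEN not_sym])
      finally show ?thesis .
    qed
    have fin_step: "finite (set_pmf (logit_step n S u \<beta> x))" if "x \<in> ?\<Omega>" for x
      using finite_subset[OF set_logit_step[OF n S that] fin] .
    have "measure_pmf.expectation (bind_pmf \<pi> (logit_step n S u \<beta>)) f =
      (\<Sum>x\<in>?\<Omega>. pmf \<pi> x *\<^sub>R measure_pmf.expectation (logit_step n S u \<beta> x) f)"
      using fin set fin_step by (intro pmf_expectation_bind) auto
    also have "\<dots> = (\<Sum>x\<in>?\<Omega>. \<Sum>i<n. m x * (\<Sum>y\<in>S i. logit_prob S u \<beta> i x y * f (x(i := y)))) / (Z * n)"
      by (simp add: pmf expectation_logit_step[OF n S] sum_divide_distrib sum_distrib_left)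
    also have "\<dots> = (\<Sum>i<n. \<Sum>x\<in>?\<Omega>. m x * f x) / (Z * n)"
      by (subst sum.swap) (simp add: site)
    also have "\<dots> = (\<Sum>x\<in>?\<Omega>. pmf \<pi> x *\<^sub>R f x)"
      using n by (simp add: pmf sum_divide_distrib)
    also have "\<dots> = measure_pmf.expectation \<pi> f"
      using fin set by (intro integral_measure_pmf[symmetric]) auto
    finally show ?thesis .
  qed
  from this[of "indicator {_}"] have "bind_pmf \<pi> (logit_step n S u \<beta>) = \<pi>"
    by (intro pmf_eqI) (simp add: pmf.rep_eq)
  with set show ?thesis unfolding is_stationary_def by blast
qed

section \<open>Iterated kernels and distance to stationarity\<close>

lemma iter_kernel_Suc: "iter_kernel K (Suc t) x = bind_pmf (iter_kernel K t x) K"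
  by (simp add: iter_kernel_def)

lemma set_iter_kernel:
  assumes "\<And>x. x \<in> \<Omega> \<Longrightarrow> set_pmf (K x) \<subseteq> \<Omega>" "x \<in> \<Omega>"
  shows "set_pmf (iter_kernel K t x) \<subseteq> \<Omega>"
  by (induction t) (use assms in \<open>auto simp: iter_kernel_Suc, auto simp: iter_kernel_def\<close>)

text \<open>The step appended last to the law acts first on the test function. This duality lets
  bounds on the increments of \<open>f\<close> propagate in time.\<close>

lemma expectation_iter_kernel_Suc:
  fixes f :: "'a \<Rightarrow> real"
  assumes "finite \<Omega>" "\<And>x. x \<in> \<Omega> \<Longrightarrow> set_pmf (K x) \<subseteq> \<Omega>" "x \<in> \<Omega>"
  shows "measure_pmf.expectation (iter_kernel K (Suc t) x) f =
    measure_pmf.expectation (iter_kernel K t x) (\<lambda>y. measure_pmf.expectation (K y) f)"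
proof -
  have set: "set_pmf (iter_kernel K t x) \<subseteq> \<Omega>" using set_iter_kernel assms by metis
  have "measure_pmf.expectation (iter_kernel K (Suc t) x) f =
    (\<Sum>y\<in>\<Omega>. pmf (iter_kernel K t x) y *\<^sub>R measure_pmf.expectation (K y) f)"
    unfolding iter_kernel_Suc using assms set
    by (intro pmf_expectation_bind) (auto intro: finite_subset)
  also have "\<dots> = measure_pmf.expectation (iter_kernel K t x) (\<lambda>y. measure_pmf.expectation (K y) f)"
    using assms set by (intro integral_measure_pmf[symmetric]) auto
  finally show ?thesis .
qed

lemma bind_iter_kernel_stationary:
  assumes "bind_pmf \<pi> K = \<pi>"
  shows "bind_pmf \<pi> (iter_kernel K t) = \<pi>"
proof (induction t)
  case 0
  then show ?case by (simp add: iter_kernel_def bind_return_pmf')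
next
  case (Suc t)
  have "bind_pmf \<pi> (iter_kernel K (Suc t)) = bind_pmf (bind_pmf \<pi> (iter_kernel K t)) K"
    unfolding iter_kernel_Suc bind_assoc_pmf ..
  then show ?case using Suc assms by simp
qed

text \<open>Stationarity makes \<pi> the \<pi>-average of the rows of the \<open>t\<close>-th power,
  so on each event a row is no farther from \<pi> than from the farthest other row.\<close>

lemma iter_kernel_near_stationary:
  assumes fin: "finite \<Omega>" and K: "\<And>x. x \<in> \<Omega> \<Longrightarrow> set_pmf (K x) \<subseteq> \<Omega>"
    and st: "is_stationary \<Omega> K \<pi>" and x: "x \<in> \<Omega>"
    and d: "\<And>y. y \<in> \<Omega> \<Longrightarrow>
      \<bar>measure_pmf.prob (iter_kernel K t x) A - measure_pmf.prob (iter_kernel K t y) A\<bar> \<le> d"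
  shows "\<bar>measure_pmf.prob (iter_kernel K t x) A - measure_pmf.prob \<pi> A\<bar> \<le> d"
proof -
  have set: "set_pmf \<pi> \<subseteq> \<Omega>" using st by (simp add: is_stationary_def)
  have sum1: "(\<Sum>y\<in>\<Omega>. pmf \<pi> y) = 1" using fin set by (rule sum_pmf_eq_1)
  have fin_iter: "finite (set_pmf (iter_kernel K t y))" if "y \<in> \<Omega>" for y
    using finite_subset[OF set_iter_kernel[of \<Omega> K y t] fin] K that by blast
  have "measure_pmf.expectation (bind_pmf \<pi> (iter_kernel K t)) (indicator A) =
    (\<Sum>y\<in>\<Omega>. pmf \<pi> y *\<^sub>R measure_pmf.expectation (iter_kernel K t y) (indicator A :: _ \<Rightarrow> real))"
    using fin set fin_iter by (intro pmf_expectation_bind) auto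
  then have "measure_pmf.prob \<pi> A = (\<Sum>y\<in>\<Omega>. pmf \<pi> y * measure_pmf.prob (iter_kernel K t y) A)"
    using st bind_iter_kernel_stationary[of \<pi> K t] by (simp add: is_stationary_def)
  moreover have "measure_pmf.prob (iter_kernel K t x) A =
      (\<Sum>y\<in>\<Omega>. pmf \<pi> y * measure_pmf.prob (iter_kernel K t x) A)"
    by (simp add: sum1 flip: sum_distrib_right)
  ultimately have "measure_pmf.prob (iter_kernel K t x) A - measure_pmf.prob \<pi> A =
    (\<Sum>y\<in>\<Omega>. pmf \<pi> y * (measure_pmf.prob (iter_kernel K t x) A - measure_pmf.prob (iter_kernel K t y) A))"
    by (simp add: right_diff_distrib sum_subtractf)
  also have "\<bar>\<dots>\<bar> \<le> (\<Sum>y\<in>\<Omega>. pmf \<pi> y * d)"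
    by (intro sum_abs[THEN order_trans] sum_mono) (auto simp: abs_mult intro!: mult_left_mono d)
  also have "\<dots> = d" by (simp add: sum1 flip: sum_distrib_right)
  finally show ?thesis .
qed

text \<open>The bound at time \<open>t\<close> controls the distance to stationarity by averaging.
  The limit of \<open>d\<close> makes the stationary distribution unique, so that
  \<open>stationary_dist\<close> denotes it.\<close>

lemma mixing_time_le:
  assumes fin: "finite \<Omega>" and ne: "\<Omega> \<noteq> {}" and K: "\<And>x. x \<in> \<Omega> \<Longrightarrow> set_pmf (K x) \<subseteq> \<Omega>"
    and ex: "\<exists>\<pi>. is_stationary \<Omega> K \<pi>"
    and d: "\<And>t x y A. x \<in> \<Omega> \<Longrightarrow> y \<in> \<Omega> \<Longrightarrow> A \<subseteq> \<Omega> \<Longrightarrow>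
      \<bar>measure_pmf.prob (iter_kernel K t x) A - measure_pmf.prob (iter_kernel K t y) A\<bar> \<le> d t"
    and lim: "d \<longlonglongrightarrow> 0" and t: "d t \<le> 1 / 4"
  shows "mixing_time \<Omega> K \<le> t"
proof -
  obtain x0 where x0: "x0 \<in> \<Omega>" using ne by auto
  have unique: "\<pi> = \<pi>'" if \<pi>: "is_stationary \<Omega> K \<pi>" and \<pi>': "is_stationary \<Omega> K \<pi>'" for \<pi> \<pi>'
  proof (rule pmf_eqI)
    fix y
    show "pmf \<pi> y = pmf \<pi>' y"
    proof (cases "y \<in> \<Omega>")
      case True
      \<comment> \<open>Both distributions are within \<open>d s\<close> of the row at
        \<open>x0\<close>.\<close>
      have "\<bar>pmf \<pi> y - pmf \<pi>' y\<bar> \<le> 2 * d s" for s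
      proof -
        have "\<bar>measure_pmf.prob (iter_kernel K s x0) {y} - measure_pmf.prob \<pi> {y}\<bar> \<le> d s"
          "\<bar>measure_pmf.prob (iter_kernel K s x0) {y} - measure_pmf.prob \<pi>' {y}\<bar> \<le> d s"
          using True by (auto intro!: iter_kernel_near_stationary[OF fin K _ x0] \<pi> \<pi>' d x0)
        then show ?thesis by (simp add: measure_pmf_single)
      qed
      moreover have "(\<lambda>s. 2 * d s) \<longlonglongrightarrow> 2 * 0" using lim by (intro tendsto_intros)
      ultimately have "\<bar>pmf \<pi> y - pmf \<pi>' y\<bar> \<le> 2 * 0"
        using LIMSEQ_le_const[of "\<lambda>s. 2 * d s" "2 * 0" "\<bar>pmf \<pi> y - pmf \<pi>' y\<bar>"] by blast
      then show ?thesis by simp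
    next
      case False
      then have "y \<notin> set_pmf \<pi>" "y \<notin> set_pmf \<pi>'" using \<pi> \<pi>' by (auto simp: is_stationary_def)
      then show ?thesis by (simp add: set_pmf_iff)
    qed
  qed
  have st: "is_stationary \<Omega> K (stationary_dist \<Omega> K)"
    unfolding stationary_dist_def using ex unique by (metis (mono_tags, lifting) theI)
  have "Max ((\<lambda>x. tv_dist \<Omega> (iter_kernel K t x) (stationary_dist \<Omega> K)) ` \<Omega>) \<le> 1 / 4"
  proof (subst Max_le_iff)
    show "\<forall>a\<in>(\<lambda>x. tv_dist \<Omega> (iter_kernel K t x) (stationary_dist \<Omega> K)) ` \<Omega>. a \<le> 1 / 4"
    proof (clarify, unfold tv_dist_def, subst Max_le_iff)
      fix x assume x: "x \<in> \<Omega>"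
      show "\<forall>a\<in>(\<lambda>A. \<bar>measure_pmf.prob (iter_kernel K t x) A - measure_pmf.prob (stationary_dist \<Omega> K) A\<bar>) ` Pow \<Omega>.
          a \<le> 1 / 4"
      proof (clarify)
        fix A assume "A \<subseteq> \<Omega>"
        then have "\<bar>measure_pmf.prob (iter_kernel K t x) A - measure_pmf.prob (stationary_dist \<Omega> K) A\<bar> \<le> d t"
          by (intro iter_kernel_near_stationary[OF fin K st x] d[OF x]) auto
        with t show "\<bar>measure_pmf.prob (iter_kernel K t x) A - measure_pmf.prob (stationary_dist \<Omega> K) A\<bar> \<le> 1 / 4"
          by linarith
      qed
    qed (use fin in auto)
  qed (use fin ne in auto)
  then show ?thesis unfolding mixing_time_def by (rule Least_le)
qed

section \<open>The OR game on the hypercube\<close>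

abbreviation OR_profiles :: "nat \<Rightarrow> (nat \<Rightarrow> nat) set" where
  "OR_profiles n \<equiv> profiles n OR_strategies"

abbreviation OR_step :: "nat \<Rightarrow> real \<Rightarrow> (nat \<Rightarrow> nat) \<Rightarrow> (nat \<Rightarrow> nat) pmf" where
  "OR_step n \<beta> \<equiv> logit_step n OR_strategies (OR_utility n) \<beta>"

definition weight :: "nat \<Rightarrow> (nat \<Rightarrow> nat) \<Rightarrow> nat" where
  "weight n x = (\<Sum>i<n. x i)"

lemma set_OR_step: "0 < n \<Longrightarrow> x \<in> OR_profiles n \<Longrightarrow> set_pmf (OR_step n \<beta> x) \<subseteq> OR_profiles n"
  by (rule set_logit_step) (auto simp: OR_strategies_def)

lemma finite_OR_profiles: "finite (OR_profiles n)"
  by (rule finite_profiles) (simp add: OR_strategies_def)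

lemma weight_eq_0_iff: "weight n x = 0 \<longleftrightarrow> (\<forall>j<n. x j = 0)"
  by (auto simp: weight_def)

text \<open>Having \<open>x i\<close> on the left avoids truncated subtraction.\<close>

lemma weight_upd: "i < n \<Longrightarrow> weight n (x(i := b)) + x i = weight n x + b"
  unfolding weight_def by (simp add: sum.remove[of "{..<n}" i])

lemma OR_profiles_cases: "x \<in> OR_profiles n \<Longrightarrow> i < n \<Longrightarrow> x i = 0 \<or> x i = 1"
  by (auto simp: profiles_def OR_strategies_def PiE_iff)

lemma OR_profiles_upd: "x \<in> OR_profiles n \<Longrightarrow> i < n \<Longrightarrow> b \<le> 1 \<Longrightarrow> x(i := b) \<in> OR_profiles n"
  by (rule profiles_upd) (auto simp: OR_strategies_def)

lemma weight_le:
  assumes "x \<in> OR_profiles n"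
  shows "weight n x \<le> n"
proof -
  have "weight n x \<le> (\<Sum>i<n. 1)"
    unfolding weight_def using OR_profiles_cases[OF assms] by (intro sum_mono) fastforce
  then show ?thesis by simp
qed

text \<open>Only the other players matter, hence entry \<open>i\<close> is first set to 0. If one of
  them plays 1, both replies of \<open>i\<close> earn -1 and the choice is fair.\<close>

definition OR_one_prob :: "nat \<Rightarrow> real \<Rightarrow> (nat \<Rightarrow> nat) \<Rightarrow> nat \<Rightarrow> real" where
  "OR_one_prob n q x i = (if weight n (x(i := 0)) = 0 then q else 1 / 2)"

lemma expectation_OR_step:
  assumes "0 < n" "q = 1 / (1 + exp \<beta>)"
  shows "measure_pmf.expectation (OR_step n \<beta> x) f =
    (\<Sum>i<n. (1 - OR_one_prob n q x i) * f (x(i := 0)) + OR_one_prob n q x i * f (x(i := 1))) / real n"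
proof -
  have "(\<Sum>y\<in>OR_strategies i. logit_prob OR_strategies (OR_utility n) \<beta> i x y * f (x(i := y))) =
    (1 - OR_one_prob n q x i) * f (x(i := 0)) + OR_one_prob n q x i * f (x(i := 1))" if i: "i < n" for i
  proof -
    have 0: "OR_utility n i (x(i := 0)) = (if weight n (x(i := 0)) = 0 then 0 else -1)"
      by (simp add: OR_utility_def weight_eq_0_iff)
    have 1: "OR_utility n i (x(i := 1)) = -1"
      using i by (auto simp: OR_utility_def)
    have pos: "1 + exp \<beta> > 0" by (simp add: add_pos_pos)
    have q: "exp (-\<beta>) / (1 + exp (-\<beta>)) = q" "1 / (1 + exp (-\<beta>)) = 1 - q"
      using pos by (auto simp: assms(2) exp_minus field_simps)
    have half: "exp (-\<beta>) / (exp (-\<beta>) + exp (-\<beta>)) = 1 / 2" by simp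
    have "logit_prob OR_strategies (OR_utility n) \<beta> i x 0 = 1 - OR_one_prob n q x i"
      "logit_prob OR_strategies (OR_utility n) \<beta> i x 1 = OR_one_prob n q x i"
      using 0 1 q half by (auto simp: OR_strategies_def logit_prob_def OR_one_prob_def)
    then show ?thesis by (simp add: OR_strategies_def)
  qed
  then have "(\<Sum>i<n. \<Sum>y\<in>OR_strategies i. logit_prob OR_strategies (OR_utility n) \<beta> i x y * f (x(i := y))) =
    (\<Sum>i<n. (1 - OR_one_prob n q x i) * f (x(i := 0)) + OR_one_prob n q x i * f (x(i := 1)))"
    by (intro sum.cong) auto
  then show ?thesis
    using assms(1) by (subst expectation_logit_step) (auto simp: OR_strategies_def)
qed

section \<open>Lipschitz functions for weighted edge lengths and their contraction\<close>

definition edge_bounded :: "nat \<Rightarrow> (nat \<Rightarrow> real) \<Rightarrow> ((nat \<Rightarrow> nat) \<Rightarrow> real) \<Rightarrow> bool" where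
  "edge_bounded n w f \<longleftrightarrow>
     (\<forall>x\<in>OR_profiles n. \<forall>j<n. x j = 0 \<longrightarrow> \<bar>f (x(j := 1)) - f x\<bar> \<le> w (weight n x))"

lemma edge_boundedD:
  "edge_bounded n w f \<Longrightarrow> x \<in> OR_profiles n \<Longrightarrow> j < n \<Longrightarrow> x j = 0 \<Longrightarrow>
    \<bar>f (x(j := 1)) - f x\<bar> \<le> w (weight n x)"
  by (simp add: edge_bounded_def)

text \<open>
  A bound for the contribution of updating a player \<open>i \<noteq> j\<close> to the increment along an edge in
  direction \<open>j\<close>, where \<open>k\<close> counts the ones outside \<open>i\<close> and \<open>j\<close>. At \<open>k = 0\<close> the lower endpoint moves
  up with probability \<open>q\<close> and the upper one with probability \<open>1 / 2\<close>.
\<close>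

definition update_bound :: "real \<Rightarrow> (nat \<Rightarrow> real) \<Rightarrow> nat \<Rightarrow> real" where
  "update_bound q w k = (if k = 0 then (1 - q) * w 0 + w 1 / 2 else (w k + w (k + 1)) / 2)"

text \<open>
  At an edge of level \<open>k\<close>, of the \<open>n - 1\<close> players other than \<open>j\<close> exactly \<open>k\<close> currently play \<open>1\<close>;
  the update of \<open>j\<close> itself contributes nothing.
\<close>

definition contracting :: "nat \<Rightarrow> real \<Rightarrow> real \<Rightarrow> (nat \<Rightarrow> real) \<Rightarrow> bool" where
  "contracting n q \<alpha> w \<longleftrightarrow>
     (\<forall>k<n. real k * update_bound q w (k - 1) + (real n - 1 - real k) * update_bound q w k
       \<le> (1 - \<alpha>) * real n * w k)"

lemma edge_bounded_update:
  assumes f: "edge_bounded n w f" and q: "0 \<le> q" "q \<le> 1 / 2"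
    and x: "x \<in> OR_profiles n" "i < n" "j < n" "i \<noteq> j" "x j = 0"
  defines "avg \<equiv> \<lambda>x. (1 - OR_one_prob n q x i) * f (x(i := 0)) + OR_one_prob n q x i * f (x(i := 1))"
  shows "\<bar>avg (x(j := 1)) - avg x\<bar> \<le> update_bound q w (weight n (x(i := 0)))"
proof -
  let ?x0 = "x(i := 0)" let ?x1 = "x(i := 1)" let ?y0 = "?x0(j := 1)" let ?y1 = "?x1(j := 1)"
  let ?l = "weight n ?x0"
  have in_profiles: "?x0 \<in> OR_profiles n" "?x1 \<in> OR_profiles n" "?y0 \<in> OR_profiles n"
    using x by (auto intro!: OR_profiles_upd)
  have w1: "weight n ?x1 = ?l + 1" and wy: "weight n ?y0 = ?l + 1"
    using x weight_upd[of i n ?x0 1] weight_upd[of j n ?x0 1] by auto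
  have y1: "?y1 = ?y0(i := 1)" using x by auto
  have e: "\<bar>f ?y0 - f ?x0\<bar> \<le> w ?l" "\<bar>f ?y1 - f ?x1\<bar> \<le> w (?l + 1)" "\<bar>f ?y1 - f ?y0\<bar> \<le> w (?l + 1)"
    using edge_boundedD[OF f in_profiles(1), of j] edge_boundedD[OF f in_profiles(2), of j]
      edge_boundedD[OF f in_profiles(3), of i] x
    unfolding w1 wy y1 by simp_all
  have ry: "OR_one_prob n q (x(j := 1)) i = 1 / 2"
    using x wy by (simp add: OR_one_prob_def fun_upd_twist)
  have ay: "avg (x(j := 1)) = f ?y0 / 2 + f ?y1 / 2"
    unfolding avg_def ry using x by (simp add: fun_upd_twist)
  show ?thesis
  proof (cases "?l = 0")
    case True
    \<comment> \<open>Monotone coupling: both endpoints move up with probability \<open>q\<close>,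
      only the upper one with probability \<open>1 / 2 - q\<close>, neither with probability
      \<open>1 / 2\<close>. The middle case crosses two edges; \<open>q \<le> 1 / 2\<close> keeps
      its coefficient nonnegative.\<close>
    have "avg (x(j := 1)) - avg x =
      q * (f ?y1 - f ?x1) + (1 / 2 - q) * ((f ?y1 - f ?y0) + (f ?y0 - f ?x0)) + (f ?y0 - f ?x0) / 2"
      unfolding ay using True by (simp add: avg_def OR_one_prob_def field_simps)
    also have "\<bar>\<dots>\<bar> \<le> q * w 1 + (1 / 2 - q) * (w 1 + w 0) + w 0 / 2"
    proof -
      have "\<bar>q * (f ?y1 - f ?x1)\<bar> \<le> q * w 1"
        unfolding abs_mult using e True q by (intro mult_mono) auto
      moreover have "\<bar>(1 / 2 - q) * ((f ?y1 - f ?y0) + (f ?y0 - f ?x0))\<bar> \<le> (1 / 2 - q) * (w 1 + w 0)"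
        unfolding abs_mult using e True q by (intro mult_mono) auto
      moreover have "\<bar>(f ?y0 - f ?x0) / 2\<bar> \<le> w 0 / 2" using e True by simp
      ultimately show ?thesis by (intro abs_triangle_ineq[THEN order_trans] add_mono)
    qed
    also have "\<dots> = update_bound q w ?l"
      using True by (simp add: update_bound_def algebra_simps)
    finally show ?thesis .
  next
    case False
    \<comment> \<open>Both endpoints now move up with the same probability \<open>1 / 2\<close>, so
      the edge is carried to a parallel edge.\<close>
    have diff: "avg (x(j := 1)) - avg x = (f ?y1 - f ?x1) / 2 + (f ?y0 - f ?x0) / 2"
      unfolding ay using False by (simp add: avg_def OR_one_prob_def field_simps)
    have bound: "update_bound q w ?l = w (?l + 1) / 2 + w ?l / 2"
      using False unfolding update_bound_def by argo
    show ?thesis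
      unfolding diff bound using e(1,2) by (intro abs_triangle_ineq[THEN order_trans] add_mono) auto
  qed
qed

lemma edge_bounded_step:
  assumes n: "0 < n" and \<beta>: "0 \<le> \<beta>" and qdef: "q = 1 / (1 + exp \<beta>)"
    and w: "contracting n q \<alpha> w" and f: "edge_bounded n w f"
  shows "edge_bounded n (\<lambda>k. (1 - \<alpha>) * w k) (\<lambda>x. measure_pmf.expectation (OR_step n \<beta> x) f)"
  unfolding edge_bounded_def
proof (intro ballI allI impI)
  fix x j assume x: "x \<in> OR_profiles n" and j: "j < n" "x j = 0"
  have q: "0 \<le> q" "q \<le> 1 / 2" using \<beta> by (auto simp: qdef field_simps add_pos_pos)
  define avg where "avg i x = (1 - OR_one_prob n q x i) * f (x(i := 0)) + OR_one_prob n q x i * f (x(i := 1))"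
    for i x
  let ?k = "weight n x" and ?B = "update_bound q w"
  \<comment> \<open>Updating \<open>j\<close> erases the only entry in which the endpoints
    differ.\<close>
  have "avg j (x(j := 1)) = avg j x" by (simp add: avg_def OR_one_prob_def)
  then have split: "(\<Sum>i<n. avg i (x(j := 1)) - avg i x) = (\<Sum>i\<in>{..<n}-{j}. avg i (x(j := 1)) - avg i x)"
    using j by (simp add: sum.remove[of "{..<n}" j])
  have k: "?k = (\<Sum>i\<in>{..<n}-{j}. x i)"
    using j by (simp add: weight_def sum.remove[of "{..<n}" j])
  have "weight n (x(j := 1)) \<le> n" using x j by (intro weight_le OR_profiles_upd) auto
  then have kn: "?k < n" using weight_upd[of j n x 1] j by simp
  \<comment> \<open>The summand is affine in \<open>x i\<close> to cover both values of the entry: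
    if \<open>x i = 1\<close>, then \<open>?k - 1\<close> ones remain. If \<open>?k = 0\<close>, no
    entry is 1, so the truncated \<open>?k - 1\<close> gets coefficient 0.\<close>
  have "\<bar>\<Sum>i<n. avg i (x(j := 1)) - avg i x\<bar> \<le>
      (\<Sum>i\<in>{..<n}-{j}. ?B ?k + real (x i) * (?B (?k - 1) - ?B ?k))"
    unfolding split
  proof (intro sum_abs[THEN order_trans] sum_mono)
    fix i assume i: "i \<in> {..<n} - {j}"
    then have "\<bar>avg i (x(j := 1)) - avg i x\<bar> \<le> ?B (weight n (x(i := 0)))"
      unfolding avg_def using edge_bounded_update[OF f q x, of i j] j by auto
    moreover have "weight n (x(i := 0)) = ?k - x i" using weight_upd[of i n x 0] i by simp
    ultimately show "\<bar>avg i (x(j := 1)) - avg i x\<bar> \<le> ?B ?k + real (x i) * (?B (?k - 1) - ?B ?k)"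
      using OR_profiles_cases[OF x, of i] i by auto
  qed
  also have "\<dots> = (real n - 1) * ?B ?k + real ?k * (?B (?k - 1) - ?B ?k)"
    using n j by (simp add: sum.distrib k of_nat_diff flip: sum_distrib_right)
  also have "\<dots> \<le> (1 - \<alpha>) * real n * w ?k"
    using w kn unfolding contracting_def by (auto simp: algebra_simps)
  finally have "\<bar>\<Sum>i<n. avg i (x(j := 1)) - avg i x\<bar> / n \<le> (1 - \<alpha>) * w ?k"
    using n by (simp add: field_simps)
  then show "\<bar>measure_pmf.expectation (OR_step n \<beta> (x(j := 1))) f
      - measure_pmf.expectation (OR_step n \<beta> x) f\<bar> \<le> (1 - \<alpha>) * w (weight n x)"
    unfolding expectation_OR_step[OF n qdef] avg_def[symmetric]
    by (simp add: sum_subtractf flip: diff_divide_distrib)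
qed

lemma contracting_scale:
  assumes "contracting n q \<alpha> w" "0 \<le> c"
  shows "contracting n q \<alpha> (\<lambda>k. c * w k)"
proof -
  have B: "update_bound q (\<lambda>k. c * w k) k = c * update_bound q w k" for k
    by (simp add: update_bound_def algebra_simps)
  have "c * (real k * update_bound q w (k - 1) + (real n - 1 - real k) * update_bound q w k)
      \<le> c * ((1 - \<alpha>) * real n * w k)" if "k < n" for k
    using assms that unfolding contracting_def by (intro mult_left_mono) auto
  then show ?thesis unfolding contracting_def B by (simp add: algebra_simps)
qed

text \<open>Turning the ones off one at a time gives a path to the zero profile that crosses each
  level below the weight once.\<close>

lemma edge_bounded_diff_zero:
  assumes f: "edge_bounded n w f" and x: "x \<in> OR_profiles n"
  shows "\<bar>f x - f (\<lambda>i\<in>{..<n}. 0)\<bar> \<le> (\<Sum>k<weight n x. w k)"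
  using x
proof (induction "weight n x" arbitrary: x)
  case 0
  then have "x = (\<lambda>i\<in>{..<n}. 0)"
    by (auto simp: profiles_def PiE_iff extensional_def weight_eq_0_iff fun_eq_iff)
  then show ?case using 0 by simp
next
  case (Suc k)
  then obtain i where i: "i < n" "x i \<noteq> 0" using weight_eq_0_iff[of n x] by auto
  then have i1: "x i = 1" using OR_profiles_cases[OF Suc.prems i(1)] by simp
  have x0: "x(i := 0) \<in> OR_profiles n" using Suc.prems i by (intro OR_profiles_upd) auto
  have k: "weight n (x(i := 0)) = k" using weight_upd[of i n x 0] i1 i Suc.hyps by simp
  have upd: "(x(i := 0))(i := 1) = x" using i1 by auto
  have "\<bar>f x - f (x(i := 0))\<bar> \<le> w k"
    using edge_boundedD[OF f x0 i(1)] unfolding k upd by simp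
  moreover have "\<bar>f (x(i := 0)) - f (\<lambda>i\<in>{..<n}. 0)\<bar> \<le> (\<Sum>k<k. w k)"
    using Suc.hyps(1)[of "x(i := 0)"] x0 k by simp
  ultimately show ?case using Suc.hyps(2) by (simp flip: Suc.hyps(2))
qed

lemma edge_bounded_iter:
  assumes n: "0 < n" and \<beta>: "0 \<le> \<beta>" and q: "q = 1 / (1 + exp \<beta>)" and \<alpha>: "\<alpha> \<le> 1"
    and w: "contracting n q \<alpha> w" and f: "edge_bounded n w f"
  shows "edge_bounded n (\<lambda>k. (1 - \<alpha>) ^ t * w k)
    (\<lambda>x. measure_pmf.expectation (iter_kernel (OR_step n \<beta>) t x) f)"
  using f w
\<comment> \<open>Both vary because the step taken first replaces \<open>f\<close> by its one-step
  average and \<open>w k\<close> by \<open>(1 - \<alpha>) * w k\<close>.\<close>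
proof (induction t arbitrary: f w)
  case 0
  then show ?case by (simp add: iter_kernel_def edge_bounded_def)
next
  case (Suc t)
  have "edge_bounded n (\<lambda>k. (1 - \<alpha>) ^ t * ((1 - \<alpha>) * w k))
    (\<lambda>x. measure_pmf.expectation (iter_kernel (OR_step n \<beta>) t x)
       (\<lambda>y. measure_pmf.expectation (OR_step n \<beta> y) f))"
    using Suc.prems \<alpha> by (intro Suc.IH edge_bounded_step[OF n \<beta> q] contracting_scale) auto
  then show ?case
    using OR_profiles_upd[of _ n _ 1]
    by (simp add: edge_bounded_def expectation_iter_kernel_Suc[OF finite_OR_profiles set_OR_step[OF n]] mult.assoc mult.left_commute)
qed

text \<open>Scaled by \<open>1 / m\<close>, \<open>w\<close> bounds the increments of every
  indicator. Comparing both starting profiles with the zero profile gives the factor 2 in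
  \<open>d\<close>, and \<open>(1 - \<alpha>) ^ t \<le> exp (- (\<alpha> * t))\<close> brings
  \<open>d t\<close> down to \<open>1 / 4\<close> once \<open>t\<close> reaches
  \<open>ln (8 * D / m) / \<alpha>\<close>. Rounding up costs the final 1.\<close>

lemma OR_mixing_time_le:
  assumes n: "0 < n" and \<beta>: "0 \<le> \<beta>" and q: "q = 1 / (1 + exp \<beta>)" and \<alpha>: "0 < \<alpha>" "\<alpha> \<le> 1"
    and w: "contracting n q \<alpha> w" and m: "0 < m" "\<And>k. k < n \<Longrightarrow> m \<le> w k" and D: "(\<Sum>k<n. w k) \<le> D"
  shows "real (OR_mixing_time n \<beta>) \<le> ln (8 * D / m) / \<alpha> + 1"
proof -
  let ?\<Omega> = "OR_profiles n" and ?K = "OR_step n \<beta>"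
  define d where "d t = 2 * D / m * (1 - \<alpha>) ^ t" for t
  have ne: "?\<Omega> \<noteq> {}" by (auto simp: profiles_def PiE_eq_empty_iff OR_strategies_def)
  have "OR_utility n i = OR_utility n 0" for i by (simp add: OR_utility_def fun_eq_iff)
  then have ex: "\<exists>\<pi>. is_stationary ?\<Omega> ?K \<pi>"
    using n by (intro logit_stationary_exists[where \<Phi> = "OR_utility n 0"]) (auto simp: OR_strategies_def)
  have wpos: "0 \<le> w k" if "k < n" for k using m that by force
  have "m \<le> w 0" "w 0 \<le> (\<Sum>k<n. w k)" using m n wpos by (auto intro!: member_le_sum)
  then have mD: "m \<le> D" using D by simp
  have dist: "\<bar>measure_pmf.prob (iter_kernel ?K t x) A - measure_pmf.prob (iter_kernel ?K t y) A\<bar> \<le> d t"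
    if x: "x \<in> ?\<Omega>" and y: "y \<in> ?\<Omega>" for t x y A
  proof -
    let ?f = "\<lambda>x. measure_pmf.expectation (iter_kernel ?K t x) (indicator A :: _ \<Rightarrow> real)"
    let ?w = "\<lambda>k. (1 - \<alpha>) ^ t * (1 / m * w k)"
    have "edge_bounded n (\<lambda>k. 1 / m * w k) (indicator A)"
      unfolding edge_bounded_def
    proof (intro ballI allI impI)
      fix x j assume x: "x \<in> ?\<Omega>" and j: "j < n" "x j = 0"
      have "weight n (x(j := 1)) \<le> n" using x j by (intro weight_le OR_profiles_upd) auto
      then have "weight n x < n" using weight_upd[of j n x 1] j by simp
      then have "1 \<le> 1 / m * w (weight n x)" using m by (simp add: field_simps)
      then show "\<bar>indicator A (x(j := 1)) - indicator A x\<bar> \<le> 1 / m * w (weight n x)"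
        by (auto simp: indicator_def)
    qed
    then have eb: "edge_bounded n ?w ?f"
      using m by (intro edge_bounded_iter[OF n \<beta> q \<alpha>(2)] contracting_scale w) auto
    have zero: "\<bar>?f x - ?f (\<lambda>i\<in>{..<n}. 0)\<bar> \<le> (1 - \<alpha>) ^ t * (D / m)" if x: "x \<in> ?\<Omega>" for x
    proof -
      have "\<bar>?f x - ?f (\<lambda>i\<in>{..<n}. 0)\<bar> \<le> (\<Sum>k<weight n x. ?w k)"
        by (rule edge_bounded_diff_zero[OF eb x])
      also have "\<dots> \<le> (\<Sum>k<n. ?w k)"
        using weight_le[OF x] m wpos \<alpha> by (intro sum_mono2) auto
      also have "\<dots> = (1 - \<alpha>) ^ t * ((\<Sum>k<n. w k) / m)"
        by (simp add: sum_distrib_left sum_divide_distrib)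
      also have "\<dots> \<le> (1 - \<alpha>) ^ t * (D / m)"
        using D m \<alpha> by (intro mult_left_mono divide_right_mono) auto
      finally show ?thesis .
    qed
    have "d t = 2 * ((1 - \<alpha>) ^ t * (D / m))" by (simp add: d_def)
    then have "\<bar>?f x - ?f y\<bar> \<le> d t" using zero[OF x] zero[OF y] by linarith
    then show ?thesis by simp
  qed
  have "d \<longlonglongrightarrow> 2 * D / m * 0"
    unfolding d_def using \<alpha> by (intro tendsto_intros LIMSEQ_power_zero) auto
  then have lim: "d \<longlonglongrightarrow> 0" by simp
  define t where "t = nat \<lceil>ln (8 * D / m) / \<alpha>\<rceil>"
  have ln0: "0 \<le> ln (8 * D / m) / \<alpha>" using mD m \<alpha> by (intro divide_nonneg_pos ln_ge_zero) (auto simp: field_simps)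
  then have t: "ln (8 * D / m) / \<alpha> \<le> t" "t \<le> ln (8 * D / m) / \<alpha> + 1" unfolding t_def by linarith+
  have pos: "8 * D / m > 0" using m mD by simp
  have "(1 - \<alpha>) ^ t \<le> exp (-\<alpha>) ^ t"
    using \<alpha> exp_ge_add_one_self[of "-\<alpha>"] by (intro power_mono) auto
  also have "\<dots> = exp (- (\<alpha> * t))" by (simp add: exp_of_nat_mult[symmetric] mult.commute)
  also have "\<dots> \<le> exp (- ln (8 * D / m))" using t \<alpha> by (simp add: field_simps)
  also have "\<dots> = m / (8 * D)" using pos by (simp add: exp_minus)
  finally have "d t \<le> 2 * D / m * (m / (8 * D))"
    unfolding d_def using m mD by (intro mult_left_mono) auto
  also have "\<dots> = 1 / 4" using m mD by simp
  finally have "d t \<le> 1 / 4" .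
  then have "mixing_time ?\<Omega> ?K \<le> t"
    using mixing_time_le[OF finite_OR_profiles ne set_OR_step[OF n] ex, of d] dist lim by blast
  then show ?thesis using t by (simp add: OR_mixing_time_def logit_mixing_time_def)
qed

section \<open>Binomial tails and the weights built from them\<close>

definition binomial_tail_ratio :: "nat \<Rightarrow> nat \<Rightarrow> real" where
  "binomial_tail_ratio N k = (\<Sum>j=k..N. real (N choose j)) / real (N choose k)"

lemma binomial_tail_ratio_0: "binomial_tail_ratio N 0 = 2 ^ N"
  using choose_row_sum[of N] unfolding binomial_tail_ratio_def
  by (simp add: atLeast0AtMost flip: of_nat_sum)

text \<open>The first term of the tail contributes 1; the rest is rescaled by the quotient
  \<open>(N - k) / (k + 1)\<close> of consecutive binomial coefficients. With denominators cleared,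
  \<open>k = N\<close> is included: both sides vanish.\<close>

lemma binomial_tail_ratio_step:
  assumes "k \<le> N"
  shows "real (N - k) * binomial_tail_ratio N (Suc k) = real (Suc k) * (binomial_tail_ratio N k - 1)"
proof (cases "k = N")
  case True
  then show ?thesis by (simp add: binomial_tail_ratio_def)
next
  case False
  then have k: "Suc k \<le> N" using assms by simp
  define C C' T where "C = real (N choose k)" and "C' = real (N choose Suc k)"
    and "T = (\<Sum>j=Suc k..N. real (N choose j))"
  have "Suc k * (N choose Suc k) = (N - k) * (N choose k)"
    using binomial_absorb_comp[of N k] binomial_absorption[of k N] by simp
  then have rel: "real (Suc k) * C' = real (N - k) * C"
    unfolding C_def C'_def of_nat_mult[symmetric] by simp
  have pos: "C > 0" "C' > 0" using k by (auto simp: C_def C'_def)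
  have "(\<Sum>j=k..N. real (N choose j)) = C + T"
    using assms unfolding T_def C_def by (simp add: sum.atLeast_Suc_atMost)
  then have "binomial_tail_ratio N k - 1 = T / C" "binomial_tail_ratio N (Suc k) = T / C'"
    using pos by (auto simp: binomial_tail_ratio_def C_def C'_def T_def add_divide_distrib)
  moreover have "real (N - k) * (T / C') = real (Suc k) * (T / C)"
  proof -
    have "real (N - k) * (T / C') = (real (N - k) * C) * T / (C * C')" using pos by simp
    also have "\<dots> = real (Suc k) * (T / C)" unfolding rel[symmetric] using pos by simp
    finally show ?thesis .
  qed
  ultimately show ?thesis by simp
qed

lemma binomial_tail_ratio_ge_1:
  assumes "k \<le> N"
  shows "1 \<le> binomial_tail_ratio N k"
proof -
  have "real (N choose k) \<le> (\<Sum>j=k..N. real (N choose j))"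
    using assms by (intro member_le_sum) auto
  then show ?thesis using assms by (simp add: binomial_tail_ratio_def)
qed

text \<open>Each \<open>N choose j\<close> is at most \<open>(N choose j) * (j choose k) = (N choose
  k) * ((N - k) choose (j - k))\<close>, and the last factors sum to a power of 2.\<close>

lemma binomial_tail_ratio_le:
  assumes "k \<le> N"
  shows "binomial_tail_ratio N k \<le> 2 ^ (N - k)"
proof -
  have "(\<Sum>j=k..N. real (N choose j)) \<le> (\<Sum>j=k..N. real (N choose k) * real ((N - k) choose (j - k)))"
  proof (rule sum_mono)
    fix j assume j: "j \<in> {k..N}"
    then have "1 \<le> j choose k" by (simp add: Suc_leI)
    then have "N choose j \<le> (N choose j) * (j choose k)" by simp
    also have "\<dots> = (N choose k) * ((N - k) choose (j - k))" using j by (intro choose_mult) auto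
    finally show "real (N choose j) \<le> real (N choose k) * real ((N - k) choose (j - k))"
      by (metis of_nat_le_iff of_nat_mult)
  qed
  also have "\<dots> = real (N choose k) * (\<Sum>j=k..N. real ((N - k) choose (j - k)))"
    by (simp add: sum_distrib_left)
  also have "(\<Sum>j=k..N. real ((N - k) choose (j - k))) = (\<Sum>i\<le>N - k. real ((N - k) choose i))"
    by (rule sum.reindex_bij_witness[where i = "\<lambda>i. i + k" and j = "\<lambda>j. j - k"]) (use assms in auto)
  also have "\<dots> = 2 ^ (N - k)"
    using choose_row_sum[of "N - k"] by (simp flip: of_nat_sum)
  finally show ?thesis using assms by (simp add: binomial_tail_ratio_def field_simps)
qed

text \<open>
  For \<open>k > 0\<close> a multiple of \<^const>\<open>binomial_tail_ratio\<close>, the increment of a function on which the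
  hypercube walk has drift linear in the weight, plus the constant \<open>2 q\<close> that accounts for
  the escape from the zero profile. The factor \<open>(1 - 2 * q) * 4 / 2 ^ n\<close> is forced by the
  contraction condition at \<open>k = 0\<close>, where it holds with equality for the largest \<open>\<alpha>\<close> allowed below.
\<close>

definition tail_weight :: "nat \<Rightarrow> real \<Rightarrow> nat \<Rightarrow> real" where
  "tail_weight n q k = (if k = 0 then 1
     else 2 * q + (1 - 2 * q) * 4 / 2 ^ n * binomial_tail_ratio (n - 1) k)"

text \<open>For \<open>k > 0\<close> the tail ratio lies between 1 and \<open>2 ^ (n - 2)\<close>,
  and the factor is chosen so that the upper end gives
  \<open>2 * q + (1 - 2 * q) = 1\<close>.\<close>

lemma tail_weight_bounds:
  assumes n: "2 \<le> n" and q: "0 \<le> q" "q \<le> 1 / 2" and k: "k < n"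
  shows "tail_weight n q k \<le> 1" "2 * q + (1 - 2 * q) * 4 / 2 ^ n \<le> tail_weight n q k"
proof -
  define c where "c = (1 - 2 * q) * 4 / 2 ^ n"
  have c: "0 \<le> c" using q by (simp add: c_def)
  obtain N where N: "n = Suc (Suc N)" using n by (metis Suc_le_D numeral_2_eq_2 Suc_le_mono)
  have c2: "c * 2 ^ N = 1 - 2 * q" by (simp add: c_def N)
  show "tail_weight n q k \<le> 1"
  proof (cases "k = 0")
    case False
    have "binomial_tail_ratio (n - 1) k \<le> 2 ^ (n - 1 - k)" using k by (intro binomial_tail_ratio_le) auto
    also have "\<dots> \<le> 2 ^ N" using False N by (intro power_increasing) auto
    finally have "c * binomial_tail_ratio (n - 1) k \<le> c * 2 ^ N" using c by (rule mult_left_mono)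
    then show ?thesis using False c2 by (simp add: tail_weight_def c_def)
  qed (simp add: tail_weight_def)
  show "2 * q + (1 - 2 * q) * 4 / 2 ^ n \<le> tail_weight n q k"
  proof (cases "k = 0")
    case True
    have "c * 1 \<le> c * 2 ^ N" using c by (intro mult_left_mono) auto
    then show ?thesis using True c2 by (simp add: tail_weight_def c_def)
  next
    case False
    have "c * 1 \<le> c * binomial_tail_ratio (n - 1) k"
      using c k by (intro mult_left_mono binomial_tail_ratio_ge_1) auto
    then show ?thesis using False by (simp add: tail_weight_def c_def)
  qed
qed

text \<open>The operator yields \<open>n * w k\<close> minus the same loss
  \<open>2 * q + c / 2\<close> at every level. As \<open>w k \<le> 1\<close>, this loss is at least
  \<open>\<alpha> * n * w k\<close>.\<close>

lemma contracting_tail_weight: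
  assumes n: "2 \<le> n" and q: "0 \<le> q" "q \<le> 1 / 2"
    and \<alpha>: "\<alpha> * real n \<le> 2 * q + (1 - 2 * q) * 2 / 2 ^ n"
  shows "contracting n q \<alpha> (tail_weight n q)"
  unfolding contracting_def
proof (intro allI impI)
  fix k assume k: "k < n"
  define w where "w = tail_weight n q"
  define c where "c = (1 - 2 * q) * 4 / 2 ^ n"
  obtain N where N: "n = Suc N" using n by (cases n) auto
  have N0: "N \<noteq> 0" using N n by simp
  define T where "T = binomial_tail_ratio N"
  have w: "w k = 2 * q + c * T k" if "k \<noteq> 0" for k
    using that by (simp add: w_def tail_weight_def c_def T_def N)
  have w0: "w 0 = 1" by (simp add: w_def tail_weight_def)
  have T: "real (N - k) * T (Suc k) = real (Suc k) * (T k - 1)" if "k \<le> N" for k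
    unfolding T_def using that by (rule binomial_tail_ratio_step)
  \<comment> \<open>\<open>w 0 = 1\<close> departs from the formula for positive levels, which would
    give \<open>2 - 2 * q\<close>; hence the recursion at 0 uses \<open>T 0\<close> instead.\<close>
  have cT0: "c * T 0 = 2 - 4 * q" by (simp add: c_def T_def N binomial_tail_ratio_0)
  have step: "real (N - k) * w (Suc k) = real (N - k) * (2 * q) + real (Suc k) * (c * T k - c)" if "k \<le> N" for k
  proof -
    have "real (N - k) * w (Suc k) = real (N - k) * (2 * q) + c * (real (N - k) * T (Suc k))"
      by (simp add: w algebra_simps)
    then show ?thesis unfolding T[OF that] by (simp add: algebra_simps)
  qed
  have "real k * update_bound q w (k - 1) + (real n - 1 - real k) * update_bound q w k
      = real n * w k - (2 * q + c / 2)"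
  proof -
    \<comment> \<open>Levels 0 and 1 involve the exceptional \<open>update_bound\<close> at 0; from
      level 2 on only the regular recursion enters.\<close>
    consider "k = 0" | "k = 1" | j where "k = Suc (Suc j)" by (metis One_nat_def not0_implies_Suc)
    then show ?thesis
    proof cases
      case 1
      then show ?thesis using step[of 0] cT0 by (simp add: update_bound_def w0 N algebra_simps)
    next
      case 2
      have "real N * w 1 = real N * (2 * q) + 2 - 4 * q - c" using step[of 0] cT0 by simp
      moreover have "(real N - 1) * w 2 = (real N - 1) * (2 * q) + 2 * (w 1 - 2 * q - c)"
        using step[of 1] N0 w[of 1] by (simp add: of_nat_diff numeral_2_eq_2)
      ultimately show ?thesis using 2
        by (simp add: update_bound_def w0 N numeral_2_eq_2 algebra_simps add_divide_distrib diff_divide_distrib)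
    next
      case (3 j)
      have jN: "Suc (Suc j) \<le> N" using 3 k N by simp
      have "(real N - real (Suc j)) * w k = (real N - real (Suc j)) * (2 * q) + real k * (w (Suc j) - 2 * q - c)"
        using step[of "Suc j"] jN w[of "Suc j"] 3 by (simp add: of_nat_diff)
      moreover have "(real N - real k) * w (Suc k) = (real N - real k) * (2 * q) + real (Suc k) * (w k - 2 * q - c)"
        using step[of k] jN w[of k] 3 by (simp add: of_nat_diff)
      ultimately show ?thesis using 3
        by (simp add: update_bound_def N algebra_simps add_divide_distrib diff_divide_distrib)
    qed
  qed
  also have "\<dots> \<le> (1 - \<alpha>) * real n * w k"
  proof -
    have c0: "0 \<le> c" using q by (simp add: c_def)
    have w1: "w k \<le> 1" and "2 * q + c \<le> w k"
      using tail_weight_bounds[OF n q k] by (auto simp: c_def w_def)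
    then have wk: "0 \<le> w k" using q c0 by linarith
    have "\<alpha> * real n * w k \<le> (2 * q + c / 2) * w k"
    proof (intro mult_right_mono)
      have "c / 2 = (1 - 2 * q) * 2 / 2 ^ n" by (simp add: c_def field_simps)
      then show "\<alpha> * real n \<le> 2 * q + c / 2" using \<alpha> by (rule ssubst)
    qed (rule wk)
    also have "\<dots> \<le> (2 * q + c / 2) * 1" using q w1 c0 by (intro mult_left_mono) auto
    finally show ?thesis by (simp add: algebra_simps)
  qed
  finally show "real k * update_bound q (tail_weight n q) (k - 1)
      + (real n - 1 - real k) * update_bound q (tail_weight n q) k \<le> (1 - \<alpha>) * real n * tail_weight n q k"
    unfolding w_def .
qed

section \<open>Exponential and polynomial bounds\<close>

lemma OR_mixing_time_tail_weight:
  assumes n: "2 \<le> n" and \<beta>: "0 \<le> \<beta>" and q: "q = 1 / (1 + exp \<beta>)" and \<alpha>: "0 < \<alpha>"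
    "\<alpha> * real n \<le> 2 * q + (1 - 2 * q) * 2 / 2 ^ n"
    and m: "0 < m" "m \<le> 2 * q + (1 - 2 * q) * 4 / 2 ^ n"
  shows "real (OR_mixing_time n \<beta>) \<le> ln (8 * real n / m) / \<alpha> + 1"
proof -
  have q': "0 \<le> q" "q \<le> 1 / 2" using \<beta> by (auto simp: q field_simps add_pos_pos)
  have "2 * q + (1 - 2 * q) * 2 / 2 ^ n \<le> 2 * q + (1 - 2 * q) * 1"
    unfolding times_divide_eq_right[symmetric] using q' n self_le_power[of "2::real" n]
    by (intro add_left_mono mult_left_mono) auto
  with \<alpha>(2) have "\<alpha> * real n \<le> 2 * q + (1 - 2 * q) * 1" by (rule order_trans)
  then have "\<alpha> * real n \<le> 1" by simp
  moreover have "\<alpha> * 1 \<le> \<alpha> * real n" using \<alpha> n by (intro mult_left_mono) auto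
  ultimately have "\<alpha> \<le> 1" by linarith
  moreover have "(\<Sum>k<n. tail_weight n q k) \<le> (\<Sum>k<n. 1)"
    using tail_weight_bounds[OF n q'] by (intro sum_mono) auto
  ultimately show ?thesis
    using n \<beta> q \<alpha> m tail_weight_bounds(2)[OF n q'] contracting_tail_weight[OF n q' \<alpha>(2)]
    by (intro OR_mixing_time_le[where w = "tail_weight n q" and q = q]) (auto intro: order_trans)
qed

lemma OR_mixing_time_exponential:
  assumes n: "2 \<le> n" and \<beta>: "0 \<le> \<beta>"
  shows "real (OR_mixing_time n \<beta>) \<le> 2 * real n powr (5/2) * 2 ^ n"
proof -
  define q where "q = 1 / (1 + exp \<beta>)"
  have q: "0 \<le> q" "q \<le> 1 / 2" using \<beta> by (auto simp: q_def field_simps add_pos_pos)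
  \<comment> \<open>This removes \<open>q\<close> from the lower bounds below and so makes them
    uniform in \<beta>.\<close>
  have "2 * q * 4 / 2 ^ n \<le> 2 * q * 1"
    unfolding times_divide_eq_right[symmetric] using q n power_increasing[of 2 n "2::real"]
    by (intro mult_left_mono) auto
  then have "4 / 2 ^ n \<le> 2 * q + (1 - 2 * q) * 4 / 2 ^ n" 
    "2 / 2 ^ n \<le> 2 * q + (1 - 2 * q) * 2 / 2 ^ n"
    using q by (auto simp: left_diff_distrib diff_divide_distrib)
  then have "real (OR_mixing_time n \<beta>) \<le> ln (8 * real n / (4 / 2 ^ n)) / (2 / 2 ^ n / real n) + 1"
    using n by (intro OR_mixing_time_tail_weight[OF n \<beta> q_def]) auto
  also have "\<dots> = ln (2 * real n * 2 ^ n) * (real n * 2 ^ n / 2) + 1" by (simp add: mult.assoc)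
  also have "ln (2 * real n * 2 ^ n) = ln (2 * real n) + real n * ln 2"
    using n by (subst ln_mult) (auto simp: ln_realpow)
  also have "\<dots> \<le> 3 * real n"
  proof -
    have "real n * ln 2 \<le> real n * 1" using ln_2_less_1 by (intro mult_left_mono) auto
    moreover have "ln (2 * real n) \<le> 2 * real n - 1" using n by (intro ln_le_minus_one) auto
    ultimately show ?thesis by linarith
  qed
  also have "3 * real n * (real n * 2 ^ n / 2) + 1 \<le> 2 * (real n * real n * 2 ^ n)"
  proof -
    have "2 * 2 * 1 \<le> real n * real n * 2 ^ n" using n by (intro mult_mono) auto
    then show ?thesis by simp
  qed
  \<comment> \<open>The weights give order \<open>n ^ 2 * 2 ^ n\<close>; the exponent is relaxed to
    \<open>5 / 2\<close> here.\<close>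
  also have "\<dots> \<le> 2 * real n powr (5/2) * 2 ^ n"
  proof -
    have "real n powr 2 \<le> real n powr (5/2)" using n by (intro powr_mono) auto
    then show ?thesis using n by (simp add: powr_numeral power2_eq_square)
  qed
  finally show ?thesis by (simp add: mult_right_mono)
qed

text \<open>Used to absorb additive constants into the logarithmic bounds for all
  \<open>n \<ge> 2\<close>.\<close>

lemma ln_nat_ge_half: "2 \<le> n \<Longrightarrow> 1 / 2 \<le> ln (real n)"
  using exp_half_le2 by (subst ln_ge_iff) auto

lemma OR_mixing_time_polynomial:
  assumes n: "2 \<le> n" and \<beta>: "0 \<le> \<beta>" "\<beta> \<le> c * ln (real n)" and c: "1 \<le> c"
  shows "real (OR_mixing_time n \<beta>) \<le> (c + 6) * (real n powr (c + 3) * ln (real n))"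
proof -
  define q where "q = 1 / (1 + exp \<beta>)"
  define R where "R = real n powr c"
  have q: "0 \<le> q" "q \<le> 1 / 2" using \<beta> by (auto simp: q_def field_simps add_pos_pos)
  have R1: "1 \<le> R" using n c by (auto simp: R_def ge_one_powr_ge_zero)
  have "exp \<beta> \<le> R" using \<beta> n by (simp add: R_def powr_def)
  \<comment> \<open>Since \<open>1 + exp \<beta> \<le> 2 * R\<close>. Thus \<open>1 / R\<close>
    serves as \<open>m\<close> and \<open>1 / R / n\<close> as \<alpha>.\<close>
  then have "1 / R \<le> 2 * q" using R1 by (simp add: q_def field_simps add_pos_pos)
  moreover have "0 \<le> (1 - 2 * q) * 2 / 2 ^ n" "0 \<le> (1 - 2 * q) * 4 / 2 ^ n" using q by auto
  ultimately have m: "1 / R \<le> 2 * q + (1 - 2 * q) * 2 / 2 ^ n" "1 / R \<le> 2 * q + (1 - 2 * q) * 4 / 2 ^ n"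
    by linarith+
  have "real (OR_mixing_time n \<beta>) \<le> ln (8 * real n / (1 / R)) / (1 / R / real n) + 1"
    using n R1 m by (intro OR_mixing_time_tail_weight[OF n \<beta>(1) q_def]) auto
  also have "\<dots> = ln (8 * real n * R) * (real n * R) + 1" by (simp add: mult.commute)
  also have "\<dots> \<le> ((c + 4) * ln (real n)) * real n powr (c + 3) + 2 * (ln (real n) * real n powr (c + 3))"
  proof (intro add_mono mult_mono)
    have "ln (8 * real n * R) = ln (2 ^ 3) + ln (real n) + c * ln (real n)"
      using n R1 by (simp add: ln_mult R_def ln_powr)
    also have "ln (2 ^ 3 :: real) = 3 * ln 2" by (subst ln_realpow) auto
    also have "\<dots> \<le> 3 * ln (real n)" using n by simp
    finally show "ln (8 * real n * R) \<le> (c + 4) * ln (real n)" by (simp add: algebra_simps)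
    have "real n * R = real n powr (c + 1)" using n by (simp add: R_def powr_add)
    also have "\<dots> \<le> real n powr (c + 3)" using n by (intro powr_mono) auto
    finally show "real n * R \<le> real n powr (c + 3)" .
    show "0 \<le> (c + 4) * ln (real n)" using n c by simp
    have "1 / 2 * 1 \<le> ln (real n) * real n powr (c + 3)"
      using n c ln_nat_ge_half[OF n] by (intro mult_mono) (auto simp: ge_one_powr_ge_zero)
    then show "1 \<le> 2 * (ln (real n) * real n powr (c + 3))" by simp
  qed (use R1 in auto)
  finally show ?thesis by (simp add: algebra_simps)
qed

section \<open>The high noise regime\<close>

text \<open>
  The gap of the previous weights is only of order \<open>q / n\<close>. When \<open>q\<close> is at least of order \<open>1 / n\<close>
  the zero profile is left so quickly that these weights give a gap of order \<open>1 / n\<close>.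
\<close>

definition step_weight :: "nat \<Rightarrow> nat \<Rightarrow> real" where
  "step_weight n k = (if k = 0 then real n / 4 else if k = 1 then 3 / 2 else 1)"

text \<open>Equality at level 2 fixes the gap \<open>1 / (2 * n)\<close>. At level 0 the constant
  \<open>5 / 2\<close> makes the terms linear in \<open>n\<close> agree:
  \<open>- 1 / 4 - 5 / 8 + 3 / 4 = - 1 / 8\<close>.\<close>

lemma contracting_step_weight:
  assumes q: "0 \<le> q" "5 / 2 \<le> q * (real n - 1)" and n: "0 < n"
  shows "contracting n q (1 / (2 * real n)) (step_weight n)"
  unfolding contracting_def
proof (intro allI impI)
  fix k assume "k < n"
  have r: "(1 - 1 / (2 * real n)) * real n * y = (real n - 1 / 2) * y" for y
    using n by (simp add: field_simps)
  consider "k = 0" | "k = 1" | "k = 2" | "k \<ge> 3" by linarith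
  then show "real k * update_bound q (step_weight n) (k - 1) + (real n - 1 - real k) * update_bound q (step_weight n) k
      \<le> (1 - 1 / (2 * real n)) * real n * step_weight n k"
    unfolding r
  proof cases
    case 1
    have "5 / 2 * (real n / 4) \<le> q * (real n - 1) * (real n / 4)" using q by (intro mult_right_mono) auto
    moreover have "real k * update_bound q (step_weight n) (k - 1) + (real n - 1 - real k) * update_bound q (step_weight n) k
      = (real n - 1) * (real n / 4) - q * (real n - 1) * (real n / 4) + 3 / 4 * (real n - 1)"
      using 1 by (simp add: update_bound_def step_weight_def algebra_simps add_divide_distrib diff_divide_distrib)
    moreover have "(real n - 1) * (real n / 4) - 5 / 2 * (real n / 4) + 3 / 4 * (real n - 1)
      \<le> (real n - 1 / 2) * (real n / 4)"
      by (simp add: algebra_simps add_divide_distrib diff_divide_distrib)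
    ultimately have "real k * update_bound q (step_weight n) (k - 1) + (real n - 1 - real k) * update_bound q (step_weight n) k
      \<le> (real n - 1 / 2) * (real n / 4)" by linarith
    then show "real k * update_bound q (step_weight n) (k - 1) + (real n - 1 - real k) * update_bound q (step_weight n) k
      \<le> (real n - 1 / 2) * step_weight n k"
      using 1 by (simp add: step_weight_def)
  next
    case 2
    have "0 \<le> q * real n" using q by simp
    then show "real k * update_bound q (step_weight n) (k - 1) + (real n - 1 - real k) * update_bound q (step_weight n) k
      \<le> (real n - 1 / 2) * step_weight n k"
      using 2 by (simp add: update_bound_def step_weight_def algebra_simps add_divide_distrib diff_divide_distrib)
  qed (auto simp: update_bound_def step_weight_def)
qed

text \<open>For large \<open>n\<close>, uniformly in \<beta>, \<open>exp \<beta>\<close> is at most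
  \<open>n / 5\<close>, which gives the required \<open>q * (n - 1) \<ge> 5 / 2\<close>.\<close>

lemma OR_mixing_time_high_noise:
  assumes \<epsilon>: "0 < \<epsilon>"
  shows "\<forall>\<^sub>F n in sequentially. \<forall>\<beta>\<ge>0. \<beta> < (1 - \<epsilon>) * ln (real n) \<longrightarrow>
    real (OR_mixing_time n \<beta>) \<le> 12 * (real n * ln (real n))"
proof -
  have "(\<lambda>n. real n powr - \<epsilon>) \<longlonglongrightarrow> 0"
    using \<epsilon> by (intro tendsto_neg_powr filterlim_real_sequentially) auto
  then have "\<forall>\<^sub>F n in sequentially. real n powr - \<epsilon> < 1 / 5"
    by (rule order_tendstoD) simp
  then show ?thesis
    using eventually_ge_at_top[of 7]
  proof eventually_elim
    case (elim n)
    show ?case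
    proof (intro allI impI)
      fix \<beta> :: real assume \<beta>: "0 \<le> \<beta>" "\<beta> < (1 - \<epsilon>) * ln (real n)"
      define q where "q = 1 / (1 + exp \<beta>)"
      have n: "2 \<le> n" using elim by simp
      have "real n powr (1 - \<epsilon>) = real n * real n powr - \<epsilon>"
        using n by (simp add: powr_diff powr_minus divide_inverse)
      also have "\<dots> \<le> real n * (1 / 5)" using elim by (intro mult_left_mono) auto
      \<comment> \<open>\<open>1 + n / 5 \<le> (n - 1) * (2 / 5)\<close> holds exactly for
        \<open>n \<ge> 7\<close>.\<close>
      finally have powr_le: "1 + real n powr (1 - \<epsilon>) \<le> (real n - 1) * (2 / 5)" using elim by simp
      have pos: "1 + exp \<beta> > 0" by (simp add: add_pos_pos)
      have "exp \<beta> \<le> real n powr (1 - \<epsilon>)" using \<beta> n by (simp add: powr_def)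
      then have "(1 + exp \<beta>) * (5 / 2) \<le> real n - 1" using powr_le by simp
      then have "5 / 2 \<le> q * (real n - 1)" using pos by (simp add: q_def field_simps)
      then have w: "contracting n q (1 / (2 * real n)) (step_weight n)"
        using pos n by (intro contracting_step_weight) (auto simp: q_def)
      have "(1 + 1) * (5 / 2) \<le> (1 + exp \<beta>) * (5 / 2)" using \<beta> by (intro mult_right_mono) auto
      also have "\<dots> \<le> real n - 1" by fact
      finally have n6: "6 \<le> real n" by simp
      \<comment> \<open>The weights lie between 1 and \<open>n\<close>, hence \<open>m = 1\<close>
        and \<open>D = n * n\<close>.\<close>
      have "(\<Sum>k<n. step_weight n k) \<le> (\<Sum>k<n. real n)"
        using n6 by (intro sum_mono) (auto simp: step_weight_def)
      then have "real (OR_mixing_time n \<beta>) \<le> ln (8 * (real n * real n) / 1) / (1 / (2 * real n)) + 1"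
        using n6 n by (intro OR_mixing_time_le[OF _ \<beta>(1) q_def _ _ w]) (auto simp: step_weight_def)
      also have "\<dots> = (ln (2 ^ 3) + 2 * ln (real n)) * (2 * real n) + 1"
        using n by (simp add: ln_mult)
      also have "ln (2 ^ 3 :: real) = 3 * ln 2" by (subst ln_realpow) auto
      also have "(3 * ln 2 + 2 * ln (real n)) * (2 * real n) + 1
          \<le> (3 * ln (real n) + 2 * ln (real n)) * (2 * real n) + real n * ln (real n)"
      proof (intro add_mono mult_right_mono)
        have "2 * (1 / 2) \<le> real n * ln (real n)"
          using n ln_nat_ge_half[OF n] by (intro mult_mono) auto
        then show "1 \<le> real n * ln (real n)" by simp
      qed (use n in auto)
      also have "\<dots> \<le> 12 * (real n * ln (real n))" using n by (simp add: algebra_simps)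
      finally show "real (OR_mixing_time n \<beta>) \<le> 12 * (real n * ln (real n))" .
    qed
  qed
qed

theorem theorem12:
  shows "(\<exists>K::real. K > 0 \<and> (\<forall>(n::nat) (\<beta>::real). n \<ge> 2 \<longrightarrow> \<beta> \<ge> 0 \<longrightarrow>
            real (OR_mixing_time n \<beta>) \<le> K * real n powr (5/2) * 2 ^ n))
       \<and> (\<forall>\<epsilon>::real. \<epsilon> > 0 \<longrightarrow> (\<exists>K::real. K > 0 \<and> (\<forall>(n::nat) (\<beta>::real). n \<ge> 2 \<longrightarrow> \<beta> \<ge> 0 \<longrightarrow>
            \<beta> < (1 - \<epsilon>) * ln (real n) \<longrightarrow>
            real (OR_mixing_time n \<beta>) \<le> K * (real n * ln (real n)))))
       \<and> (\<forall>c::real. c \<ge> 1 \<longrightarrow> (\<exists>K::real. K > 0 \<and> (\<forall>(n::nat) (\<beta>::real). n \<ge> 2 \<longrightarrow> \<beta> \<ge> 0 \<longrightarrow>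
            \<beta> \<le> c * ln (real n) \<longrightarrow>
            real (OR_mixing_time n \<beta>) \<le> K * (real n powr (c + 3) * ln (real n)))))"
proof (intro conjI allI impI)
  show "\<exists>K::real. K > 0 \<and> (\<forall>(n::nat) (\<beta>::real). n \<ge> 2 \<longrightarrow> \<beta> \<ge> 0 \<longrightarrow>
            real (OR_mixing_time n \<beta>) \<le> K * real n powr (5/2) * 2 ^ n)"
    using OR_mixing_time_exponential by (intro exI[of _ 2]) auto
next
  fix c :: real assume "c \<ge> 1"
  then show "\<exists>K::real. K > 0 \<and> (\<forall>(n::nat) (\<beta>::real). n \<ge> 2 \<longrightarrow> \<beta> \<ge> 0 \<longrightarrow>
            \<beta> \<le> c * ln (real n) \<longrightarrow>
            real (OR_mixing_time n \<beta>) \<le> K * (real n powr (c + 3) * ln (real n)))"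
    using OR_mixing_time_polynomial by (intro exI[of _ "c + 6"]) auto
next
  fix \<epsilon> :: real assume "\<epsilon> > 0"
  then obtain N where N: "real (OR_mixing_time n \<beta>) \<le> 12 * (real n * ln (real n))"
    if "N \<le> n" "0 \<le> \<beta>" "\<beta> < (1 - \<epsilon>) * ln (real n)" for n \<beta>
    using OR_mixing_time_high_noise unfolding eventually_sequentially by blast
  \<comment> \<open>\<open>N\<close> depends on \<epsilon> alone, so for \<open>n < N\<close> the
    exponential bound at \<open>N\<close> is an admissible constant.\<close>
  define K where "K = 12 + 2 * real N powr (5/2) * 2 ^ N"
  have "real (OR_mixing_time n \<beta>) \<le> K * (real n * ln (real n))"
    if n: "2 \<le> n" and \<beta>: "0 \<le> \<beta>" "\<beta> < (1 - \<epsilon>) * ln (real n)" for n \<beta>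
  proof -
    have "2 * (1 / 2) \<le> real n * ln (real n)"
      using n ln_nat_ge_half[OF n] by (intro mult_mono) auto
    then have x: "1 \<le> real n * ln (real n)" by simp
    show ?thesis
    proof (cases "N \<le> n")
      case True
      have "12 * (real n * ln (real n)) \<le> K * (real n * ln (real n))"
        using x by (intro mult_right_mono) (auto simp: K_def)
      then show ?thesis using N[OF True \<beta>] by linarith
    next
      case False
      have "real (OR_mixing_time n \<beta>) \<le> 2 * real n powr (5/2) * 2 ^ n"
        using n \<beta> by (intro OR_mixing_time_exponential) auto
      also have "\<dots> \<le> 2 * real N powr (5/2) * 2 ^ N"
        using False by (intro mult_mono powr_mono2 power_increasing) auto
      also have "\<dots> \<le> K * 1" by (simp add: K_def)
      also have "\<dots> \<le> K * (real n * ln (real n))"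
        using x by (intro mult_left_mono) (auto simp: K_def)
      finally show ?thesis .
    qed
  qed
  moreover have "K > 0" by (simp add: K_def add_pos_nonneg)
  ultimately show "\<exists>K::real. K > 0 \<and> (\<forall>(n::nat) (\<beta>::real). n \<ge> 2 \<longrightarrow> \<beta> \<ge> 0 \<longrightarrow>
            \<beta> < (1 - \<epsilon>) * ln (real n) \<longrightarrow>
            real (OR_mixing_time n \<beta>) \<le> K * (real n * ln (real n)))" by blast
qed

end
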